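(* Let $V$ be a real inner-product space of finite dimension $n \ge 1$, and let $T: V \to V$ be any invertible linear operator on $V$. Then there exist a diagonal operator $D$, an axonal operator $A$ and a rotational operator $R$ on $V$ such that $T = D \circ A \circ R$.
   Context: Throughout, $V$ is a real inner-product space of dimension $n\in\mathbb{N}$, $n\ge 1$. Diagonal operator: a linear operator $D$ on $V$ for which there is a (not necessarily orthogonal) basis of $V$ consisting of eigenvectors of $D$. Rotation: let $W$ be a two-dimensional subspace of $V$ with orthonormal basis $\{u,v\}$. For a fixed real number $\theta$, the linear operator on $W$ determined by $u\mapsto (\cos\theta)u+(\sin\theta)v$, $v\mapsto(-\sin\theta)u+(\cos\theta)v$ is called a rotation of $W$. Rotational operator: a linear operator on $V$ of the form $\rho\oplus \mathrm{id}$, where $\rho$ is a rotation of some two-dimensional subspace $W$ of $V$ and $\mathrm{id}$ is the identity on $W^\perp$. When $\dim V=1$, the identity operator on $V$ is also called a rotational operator. Equimodular basis: a basis $\{u_i\}_{i=1}^n$ of $V$ for which there is a real $\delta>0$ with $\|u_i\|=\delta$ for all $i$. Axial-vector: a non-zero vector $\alpha\in V$ is an axial-vector of a basis $\{u_i\}_{i=1}^n$ of $V$ if $\langle u_i,\alpha\rangle\langle u_j,u_j\rangle^{1/2}=\langle u_j,\alpha\rangle\langle u_i,u_i\rangle^{1/2}$ for all $i,j\in\{1,\dots,n\}$. Every basis of $V$ has an axial-vector, and any two axial-vectors of a given basis are linearly dependent; the axis of a basis is the span of $\{\alpha\}$ for any axial-vector $\alpha$ of that basis. Axonal operator: an invertible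 linear operator on $V$ that maps some equimodular basis $\mathcal{B}$ of $V$ to an equimodular basis $\mathcal{B}'$ of $V$ such that $\mathcal{B}$ and $\mathcal{B}'$ have the same axis. *)

theory Defs
  imports "HOL-Analysis.Analysis"
begin

text \<open>
  The space \<open>V\<close> is a type of class \<open>euclidean_space\<close>, of dimension \<open>DIM('a) \<ge> 1\<close>. Bases are
  unordered, i.e. sets of vectors: every notion below is invariant under reindexing.
\<close>

definition is_basis :: "'a::euclidean_space set \<Rightarrow> bool" where
  "is_basis B \<longleftrightarrow> independent B \<and> span B = UNIV"

definition eigenvector_of :: "('a::real_vector \<Rightarrow> 'a) \<Rightarrow> 'a \<Rightarrow> bool" where
  "eigenvector_of f x \<longleftrightarrow> x \<noteq> 0 \<and> (\<exists>c::real. f x = c *\<^sub>R x)"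

definition diagonal_operator :: "('a::euclidean_space \<Rightarrow> 'a) \<Rightarrow> bool" where
  "diagonal_operator D \<longleftrightarrow> linear D \<and> (\<exists>B. is_basis B \<and> (\<forall>x\<in>B. eigenvector_of D x))"

text \<open>
  Only the values of \<open>\<rho>\<close> on \<open>W\<close> matter. The last conjunct gives the images of \<open>u\<close> and \<open>v\<close>, already
  extended linearly to \<open>W\<close>. The subspace \<open>W\<close> is two-dimensional because \<open>u\<close>, \<open>v\<close> are orthonormal.
\<close>

definition rotation_of :: "'a::euclidean_space set \<Rightarrow> ('a \<Rightarrow> 'a) \<Rightarrow> bool" where
  "rotation_of W \<rho> \<longleftrightarrow>
    (\<exists>u v \<theta>. norm u = 1 \<and> norm v = 1 \<and> orthogonal u v \<and> span {u, v} = W \<and>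
      (\<forall>a b::real. \<rho> (a *\<^sub>R u + b *\<^sub>R v) =
         a *\<^sub>R (cos \<theta> *\<^sub>R u + sin \<theta> *\<^sub>R v) + b *\<^sub>R (- sin \<theta> *\<^sub>R u + cos \<theta> *\<^sub>R v)))"

definition rotational_operator :: "('a::euclidean_space \<Rightarrow> 'a) \<Rightarrow> bool" where
  "rotational_operator R \<longleftrightarrow> linear R \<and>
    ((\<exists>W. subspace W \<and> dim W = 2 \<and> rotation_of W R \<and> (\<forall>x\<in>W\<^sup>\<bottom>. R x = x)) \<or>
     (DIM('a) = 1 \<and> R = id))"

definition equimodular_basis :: "'a::euclidean_space set \<Rightarrow> bool" where
  "equimodular_basis B \<longleftrightarrow> is_basis B \<and> (\<exists>\<delta>>0. \<forall>u\<in>B. norm u = \<delta>)"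

definition axial_vector :: "'a::euclidean_space set \<Rightarrow> 'a \<Rightarrow> bool" where
  "axial_vector B \<alpha> \<longleftrightarrow> is_basis B \<and> \<alpha> \<noteq> 0 \<and>
    (\<forall>u\<in>B. \<forall>w\<in>B. inner u \<alpha> * sqrt (inner w w) = inner w \<alpha> * sqrt (inner u u))"

text \<open>
  Every basis has an axial-vector and any two are linearly dependent, so \<open>is_axis B\<close> holds of
  exactly one line for each basis \<open>B\<close>.
\<close>

definition is_axis :: "'a::euclidean_space set \<Rightarrow> 'a set \<Rightarrow> bool" where
  "is_axis B L \<longleftrightarrow> (\<exists>\<alpha>. axial_vector B \<alpha> \<and> L = span {\<alpha>})"

definition axonal_operator :: "('a::euclidean_space \<Rightarrow> 'a) \<Rightarrow> bool" where
  "axonal_operator A \<longleftrightarrow> linear A \<and> bij A \<and>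
    (\<exists>B. equimodular_basis B \<and> equimodular_basis (A ` B) \<and>
         (\<exists>L. is_axis B L \<and> is_axis (A ` B) L))"

end

theory Submission
  imports Defs
begin

text \<open>
  The operator \<open>T\<close> maps an orthonormal basis \<open>B\<close> to a basis \<open>T ` B\<close>, and the diagonal operator
  \<open>D\<close> with \<open>D v = \<parallel>v\<parallel> v\<close> for \<open>v \<in> T ` B\<close> absorbs the lengths: \<open>D\<^sup>-\<^sup>1 \<circ> T\<close> maps \<open>B\<close> to a basis of unit
  vectors. A rotation \<open>R\<close> in the plane of the two axes moves the axis of \<open>B\<close> to the axis of the
  normalised \<open>T ` B\<close>; as \<open>R\<close> is an isometry, \<open>A = D\<^sup>-\<^sup>1 \<circ> T \<circ> R\<^sup>-\<^sup>1\<close> is axonal on \<open>R ` B\<close>.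
\<close>

lemma is_basis_bij_image:
  fixes f :: "'a::euclidean_space \<Rightarrow> 'b::euclidean_space"
  assumes "linear f" "bij f" "is_basis B"
  shows "is_basis (f ` B)"
proof -
  have "independent (f ` B)"
    using assms linear_independent_injective_image[of f B]
    by (auto simp: is_basis_def bij_def intro: inj_on_subset)
  moreover have "span (f ` B) = UNIV"
    using assms linear_span_image[of f B] by (simp add: is_basis_def bij_def)
  ultimately show ?thesis by (simp add: is_basis_def)
qed

lemma is_basis_nonempty:
  fixes B :: "'a::euclidean_space set"
  assumes "is_basis B"
  shows "B \<noteq> {}"
proof
  assume "B = {}"
  then have "(UNIV :: 'a set) = {0}" using assms by (simp add: is_basis_def)
  then show False using nonzero_Basis SOME_Basis by blast
qed

text \<open>Prescribing the value 1 on every basis vector defines a linear functional, and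
  \<open>adjoint f 1\<close> is the vector that represents it under the inner product. For a basis
  of unit vectors this is an axial-vector.\<close>

lemma basis_equal_inner_vector:
  assumes "is_basis B"
  obtains \<alpha> where "\<alpha> \<noteq> 0" "\<And>u. u \<in> B \<Longrightarrow> inner u \<alpha> = 1"
proof -
  obtain f :: "'a \<Rightarrow> real" where f: "linear f" "\<forall>x\<in>B. f x = 1"
    using assms linear_independent_extend[of B "\<lambda>_. 1::real"] by (auto simp: is_basis_def)
  define \<alpha> where "\<alpha> = adjoint f 1"
  have \<alpha>: "inner u \<alpha> = 1" if "u \<in> B" for u
    using adjoint_works[OF f(1), of u 1] f(2) that by (simp add: \<alpha>_def)
  moreover have "\<alpha> \<noteq> 0"
    using is_basis_nonempty[OF assms] \<alpha> by fastforce
  ultimately show ?thesis using that by blast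
qed

text \<open>With unit vectors both square roots in \<open>axial_vector\<close> equal 1, so the
  condition reduces to equality of all the inner products with \<alpha>.\<close>

lemma axial_vector_unit_basis:
  assumes "is_basis B" "\<alpha> \<noteq> 0" "\<And>u. u \<in> B \<Longrightarrow> norm u = 1" "\<And>u. u \<in> B \<Longrightarrow> inner u \<alpha> = c"
  shows "axial_vector B \<alpha>"
  using assms by (simp add: axial_vector_def flip: norm_eq_sqrt_inner)

text \<open>One Gram-Schmidt step: \<open>v\<close> is the normalised part of \<open>w\<close>
  orthogonal to \<open>u\<close>. If that part vanishes, any unit vector orthogonal to
  \<open>u\<close> serves with \<open>b = 0\<close>; this is where the dimension bound
  enters.\<close>

lemma orthonormal_partner:
  fixes u w :: "'a::euclidean_space"
  assumes "norm u = 1" "DIM('a) \<ge> 2"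
  obtains v b where "norm v = 1" "inner u v = 0" "w = inner w u *\<^sub>R u + b *\<^sub>R v"
proof -
  define z where "z = w - inner w u *\<^sub>R u"
  have uu: "inner u u = 1" using assms(1) by (simp add: norm_eq_1)
  have uz: "inner u z = 0" by (simp add: z_def inner_diff_right uu inner_commute)
  show ?thesis
  proof (cases "z = 0")
    case True
    obtain y where y: "y \<noteq> 0" "orthogonal u y"
      using orthogonal_to_vector_exists[OF assms(2)] by blast
    show ?thesis
      by (rule that[of "y /\<^sub>R norm y" 0]) (use y True in \<open>auto simp: orthogonal_def z_def\<close>)
  next
    case False
    show ?thesis
      by (rule that[of "z /\<^sub>R norm z" "norm z"]) (use uz False in \<open>auto simp: z_def\<close>)
  qed
qed

lemma plane_rotation:
  fixes u v :: "'a::euclidean_space"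
  assumes "norm u = 1" "norm v = 1" "inner u v = 0"
  obtains R where "rotational_operator R" "orthogonal_transformation R"
    "R u = cos \<theta> *\<^sub>R u + sin \<theta> *\<^sub>R v"
proof -
  \<comment> \<open>\<open>R\<close> adds to \<open>x\<close> the difference between the rotated and
    the original projection of \<open>x\<close> to the plane of \<open>u\<close> and
    \<open>v\<close>. It is thus defined on the whole space at once and fixes the orthogonal
    complement.\<close>
  define R where "R x = x + (inner x u * (cos \<theta> - 1) - inner x v * sin \<theta>) *\<^sub>R u
    + (inner x u * sin \<theta> + inner x v * (cos \<theta> - 1)) *\<^sub>R v" for x
  have ip: "inner u u = 1" "inner v v = 1" "inner u v = 0" "inner v u = 0"
    using assms by (auto simp: norm_eq_1 inner_commute)
  have lin: "linear R"
    by (rule linearI) (simp_all add: R_def inner_left_distrib algebra_simps)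
  have orth: "orthogonal_transformation R"
    unfolding orthogonal_transformation
  proof (intro conjI allI lin)
    fix x
    define p q where "p = inner x u" and "q = inner x v"
    define s t where "s = p * (cos \<theta> - 1) - q * sin \<theta>" and "t = p * sin \<theta> + q * (cos \<theta> - 1)"
    have "R x = x + s *\<^sub>R u + t *\<^sub>R v" by (simp add: R_def s_def t_def p_def q_def)
    then have "inner (R x) (R x) = inner x x + (2 * s * p + 2 * t * q + s ^ 2 + t ^ 2)"
      by (simp add: inner_left_distrib inner_right_distrib ip inner_commute[of u x]
          inner_commute[of v x] p_def q_def power2_eq_square algebra_simps)
    \<comment> \<open>The left side is \<open>(p + s)^2 + (q + t)^2 - p^2 - q^2\<close>, the change
      in squared length of the planar projection. Keeping the last factor unsimplified makes this a
      polynomial identity in \<open>sin\<close> and \<open>cos\<close>, within reach of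
      \<open>algebra\<close>.\<close>
    also have "2 * s * p + 2 * t * q + s ^ 2 + t ^ 2 = (p ^ 2 + q ^ 2) * (sin \<theta> ^ 2 + cos \<theta> ^ 2 - 1)"
      unfolding s_def t_def by algebra
    also have "\<dots> = 0" by simp
    finally show "norm (R x) = norm x" by (simp add: norm_eq_sqrt_inner)
  qed
  have "rotational_operator R"
    unfolding rotational_operator_def
  proof (intro conjI disjI1 exI[of _ "span {u, v}"] ballI lin)
    have "u \<noteq> v" "pairwise orthogonal {u, v}" "0 \<notin> {u, v}"
      using ip by (auto simp: pairwise_def orthogonal_def)
    then have "independent {u, v}" using pairwise_orthogonal_independent by blast
    then show "dim (span {u, v}) = 2"
      using \<open>u \<noteq> v\<close> by (simp add: dim_span_eq_card_independent del: dim_span)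
    show "rotation_of (span {u, v}) R"
      unfolding rotation_of_def
      by (intro exI[of _ u] exI[of _ v] exI[of _ \<theta>])
        (use assms ip in \<open>auto simp: orthogonal_def R_def inner_left_distrib algebra_simps\<close>)
    show "R x = x" if "x \<in> (span {u, v})\<^sup>\<bottom>" for x
    proof -
      have "inner x u = 0" "inner x v = 0"
        using that by (auto simp: orthogonal_comp_def orthogonal_def span_base inner_commute)
      then show ?thesis by (simp add: R_def)
    qed
  qed simp
  moreover have "R u = cos \<theta> *\<^sub>R u + sin \<theta> *\<^sub>R v"
    by (simp add: R_def ip algebra_simps)
  ultimately show ?thesis using orth that by blast
qed

text \<open>Both vectors may be rescaled to unit length, since only their spans matter; a rotation
  in a plane containing them then takes one to the other. In dimension one there is a single line,
  and the identity suffices.\<close>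

lemma rotational_operator_line_to_line:
  fixes \<alpha> \<beta> :: "'a::euclidean_space"
  assumes "\<alpha> \<noteq> 0" "\<beta> \<noteq> 0"
  obtains R where "rotational_operator R" "orthogonal_transformation R" "span {R \<alpha>} = span {\<beta>}"
proof (cases "DIM('a) = 1")
  case True
  have "span {x} = UNIV" if "x \<noteq> 0" for x :: 'a
    using that True dim_eq_full[of "{x}"] by simp
  then have "span {id \<alpha>} = span {\<beta>}" using assms by simp
  moreover have "rotational_operator (id :: 'a \<Rightarrow> 'a)"
    using True by (simp add: rotational_operator_def linear_id)
  ultimately show ?thesis using that orthogonal_transformation_id by (simp add: id_def)
next
  case False
  then have dim: "DIM('a) \<ge> 2" using DIM_positive[where 'a='a] by linarith
  define u w where "u = \<alpha> /\<^sub>R norm \<alpha>" and "w = \<beta> /\<^sub>R norm \<beta>"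
  have nu: "norm u = 1" and nw: "norm w = 1" using assms by (auto simp: u_def w_def)
  obtain v b where v: "norm v = 1" "inner u v = 0" and w: "w = inner w u *\<^sub>R u + b *\<^sub>R v"
    using orthonormal_partner[OF nu dim] .
  define a where "a = inner w u"
  have w': "w = a *\<^sub>R u + b *\<^sub>R v" using w by (simp add: a_def)
  \<comment> \<open>The coordinates of the unit vector \<open>w\<close> in the orthonormal pair
    \<open>u\<close>, \<open>v\<close> form a point of the unit circle, whose angle is the required
    \<theta>.\<close>
  have "inner (a *\<^sub>R u + b *\<^sub>R v) (a *\<^sub>R u + b *\<^sub>R v) = 1"
    using nw w' by (simp add: norm_eq_1)
  then have "a\<^sup>2 + b\<^sup>2 = 1"
    using nu v by (simp add: norm_eq_1 inner_left_distrib inner_right_distrib inner_commute[of v u]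
        power2_eq_square)
  then obtain \<theta> where \<theta>: "a = cos \<theta>" "b = sin \<theta>" using sincos_total_2pi by metis
  obtain R where R: "rotational_operator R" "orthogonal_transformation R" "R u = w"
    using plane_rotation[OF nu v] w' \<theta> by metis
  have "\<alpha> = norm \<alpha> *\<^sub>R u" using assms by (simp add: u_def)
  then have "R \<alpha> = norm \<alpha> *\<^sub>R w"
    using R(2,3) orthogonal_transformation_linear linear_cmul by metis
  then have "R \<alpha> = (norm \<alpha> / norm \<beta>) *\<^sub>R \<beta>" by (simp add: w_def divide_inverse)
  moreover have "span {(norm \<alpha> / norm \<beta>) *\<^sub>R \<beta>} = span {\<beta>}"
    using assms span_image_scale[of "{\<beta>}" "\<lambda>_. norm \<alpha> / norm \<beta>"] by simp
  ultimately show ?thesis using R that by simp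
qed

theorem theorem4p1:
  fixes T :: "'a::euclidean_space \<Rightarrow> 'a"
  assumes "linear T" and "bij T"
  shows "\<exists>D A R. diagonal_operator D \<and> axonal_operator A \<and> rotational_operator R \<and>
           T = D \<circ> A \<circ> R"
proof -
  let ?B = "Basis :: 'a set"
  have B: "is_basis ?B" by (simp add: is_basis_def independent_Basis)
  have TB: "is_basis (T ` ?B)" using is_basis_bij_image[OF assms B] .
  have T0: "T b \<noteq> 0" if "b \<in> ?B" for b
    using that assms TB dependent_zero[of "T ` ?B"] by (force simp: is_basis_def)
  obtain D where D: "linear D" "\<forall>v\<in>T ` ?B. D v = norm v *\<^sub>R v"
    using TB linear_independent_extend[of "T ` ?B" "\<lambda>v. norm v *\<^sub>R v"] by (auto simp: is_basis_def)
  have diag: "diagonal_operator D"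
    unfolding diagonal_operator_def
    using D TB T0 by (auto simp: eigenvector_of_def intro!: exI[of _ "T ` ?B"])

  obtain \<alpha> where \<alpha>: "\<alpha> \<noteq> 0" "\<And>u. u \<in> ?B \<Longrightarrow> inner u \<alpha> = 1"
    using basis_equal_inner_vector[OF B] by blast

  \<comment> \<open>\<open>S\<close> is the composite of \<open>T\<close> with the inverse of
    \<open>D\<close>, given by its values on the basis instead of by inverting
    \<open>D\<close>.\<close>
  obtain S where S: "linear S" "\<forall>b\<in>?B. S b = T b /\<^sub>R norm (T b)"
    using linear_independent_extend[OF independent_Basis, of "\<lambda>b. T b /\<^sub>R norm (T b)"] by auto
  have DS: "D (S x) = T x" for x
  proof (rule linear_eq_on[of "\<lambda>x. D (S x)" T x ?B])
    show "linear (\<lambda>x. D (S x))" using linear_compose[OF S(1) D(1)] by (simp add: o_def)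
    show "D (S b) = T b" if "b \<in> ?B" for b
      using that S(2) D T0 by (simp add: linear_cmul)
  qed (use assms in auto)
  \<comment> \<open>Injectivity of \<open>T\<close>, the composite of \<open>D\<close> after
    \<open>S\<close>, passes to the inner factor \<open>S\<close>; finite dimension then gives
    surjectivity.\<close>
  have "inj S"
    by (rule injI) (metis DS assms(2) bij_pointE)
  then have bijS: "bij S"
    using linear_injective_imp_surjective[OF S(1)] by (simp add: bij_def)
  have SB: "is_basis (S ` ?B)" using is_basis_bij_image[OF S(1) bijS B] .
  have nS: "norm u = 1" if "u \<in> S ` ?B" for u
    using that S(2) T0 by auto
  obtain \<beta> where \<beta>: "\<beta> \<noteq> 0" "\<And>u. u \<in> S ` ?B \<Longrightarrow> inner u \<beta> = 1"
    using basis_equal_inner_vector[OF SB] by blast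
  obtain R where R: "rotational_operator R" and oR: "orthogonal_transformation R"
    and axes: "span {R \<alpha>} = span {\<beta>}"
    using rotational_operator_line_to_line[OF \<alpha>(1) \<beta>(1)] .
  have bijR: "bij R" and linR: "linear R"
    using oR orthogonal_transformation_bij orthogonal_transformation_linear by auto
  define A where "A = S \<circ> inv R"
  have oI: "orthogonal_transformation (inv R)" using orthogonal_transformation_inv[OF oR] .
  have linA: "linear A"
    unfolding A_def using linear_compose[OF orthogonal_transformation_linear[OF oI] S(1)] .
  have bijA: "bij A"
    unfolding A_def using bij_comp[OF bij_imp_bij_inv[OF bijR] bijS] .
  have AR: "A (R x) = S x" for x
    using bijR by (simp add: A_def bij_is_inj)
  have RB: "is_basis (R ` ?B)" using is_basis_bij_image[OF linR bijR B] .
  have nR: "norm u = 1" if "u \<in> R ` ?B" for u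
    using that oR by (auto simp: orthogonal_transformation_norm)
  have ARB: "A ` R ` ?B = S ` ?B" by (simp add: image_image AR)
  \<comment> \<open>The isometry \<open>R\<close> preserves inner products, so it carries the
    axial-vector \<alpha> of the standard basis to one of the image basis.\<close>
  have "axial_vector (R ` ?B) (R \<alpha>)"
  proof (rule axial_vector_unit_basis[where c=1])
    show "R \<alpha> \<noteq> 0" using \<alpha>(1) oR by (metis norm_eq_zero orthogonal_transformation_norm)
    show "inner u (R \<alpha>) = 1" if "u \<in> R ` ?B" for u
      using that \<alpha>(2) oR by (auto simp: orthogonal_transformation_def)
  qed (use RB nR in auto)
  moreover have "axial_vector (S ` ?B) \<beta>"
    using axial_vector_unit_basis[OF SB \<beta>(1) nS \<beta>(2)] .
  \<comment> \<open>The common axis is \<open>span {\<beta>}\<close>, which equals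
    \<open>span {R \<alpha>}\<close> by the choice of \<open>R\<close>.\<close>
  ultimately have "\<exists>L. is_axis (R ` ?B) L \<and> is_axis (A ` R ` ?B) L"
    unfolding is_axis_def ARB using axes by metis
  moreover have "equimodular_basis (R ` ?B)" "equimodular_basis (A ` R ` ?B)"
    unfolding equimodular_basis_def ARB using RB nR SB nS zero_less_one by blast+
  ultimately have "axonal_operator A"
    unfolding axonal_operator_def using linA bijA by blast
  moreover have "T = D \<circ> A \<circ> R" by (rule ext) (simp add: AR DS)
  ultimately show ?thesis using diag R by blast
qed

end
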